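(* For every $n, d, C$ such that $\frac dn\ge \frac{2}{C-1}$, there is a graph $G$ on $N=C^n$ vertices that is missing at most $N^{e}$ edges (i.e. $\binom N2-|E(G)|\le N^{e}$), for $$e = 1+\frac{H(d/n)+(1-d/n)\log_2(C-1)}{\log_2 C}+o(1),$$ and that can be covered by $N^{f}$ disjoint induced matchings (i.e. the edges of $G$ are covered by $N^f$ pairwise edge-disjoint induced matchings of $G$), where $$f = 2-\frac{1-H(d/n)}{\log_2 C}+o(1).$$
   Context: Here $n, d, C$ are positive integers, and $H(x)=-x\log_2 x-(1-x)\log_2(1-x)$ is the binary entropy function. An induced matching in a graph $G$ is a set of pairwise vertex-disjoint edges of $G$ such that the subgraph of $G$ induced on the set of endpoints of these edges contains no other edges. The $o(1)$ terms tend to $0$ as $n\to\infty$ with $C$ fixed.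
   Formalization: Proved for d/n ≤ 1/2 and C ≥ 2: without an upper bound on d/n the claim fails (for d = n and C ≥ 3, count non-adjacent pairs inside the matchings), and for C = 1 the quantity 2/(C−1) is undefined. *)

theory Defs
  imports Complex_Main
begin

(* At x = 0 and x = 1 the library convention
   log 2 0 = 0 gives the usual value 0. *)
definition binary_entropy :: "real \<Rightarrow> real" where
  "binary_entropy x = - x * log 2 x - (1 - x) * log 2 (1 - x)"

definition simple_graph :: "'a set \<Rightarrow> 'a set set \<Rightarrow> bool" where
  "simple_graph V E \<longleftrightarrow> finite V \<and> (\<forall>e\<in>E. e \<subseteq> V \<and> card e = 2)"

definition induced_edges :: "'a set set \<Rightarrow> 'a set \<Rightarrow> 'a set set" where
  "induced_edges E S = {e \<in> E. e \<subseteq> S}"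

(* The union of M is the set of endpoints of the matching edges. *)
definition induced_matching :: "'a set set \<Rightarrow> 'a set set \<Rightarrow> bool" where
  "induced_matching E M \<longleftrightarrow>
     M \<subseteq> E \<and> pairwise disjnt M \<and> induced_edges E (\<Union>M) = M"

(* The matchings in MM are pairwise disjoint as sets of edges; they may share vertices. *)
definition disjoint_induced_matching_cover :: "'a set set \<Rightarrow> 'a set set set \<Rightarrow> bool" where
  "disjoint_induced_matching_cover E MM \<longleftrightarrow>
     finite MM \<and> (\<forall>M\<in>MM. induced_matching E M) \<and> pairwise disjnt MM \<and> \<Union>MM = E"

end

theory Submission
  imports Defs "HOL-Library.FuncSet"
begin

text \<open>
  The vertices are the words of length $n$ over an alphabet of size $C$, and two words are adjacent
  iff they agree in fewer than $d$ positions. Let $L$ be a binary linear code of length $n$ and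
  minimum weight $d$ that contains the all-ones vector (codewords are encoded as sets of positions,
  with symmetric difference as addition). It acts on ordered pairs of words by swapping the two
  words on the positions of a codeword, and this action preserves the set of agreements. The orbit
  of an edge is an induced matching: two words that take part in it, via codewords $k$ and $l$,
  agree outside of $k + l$, so they are adjacent only if the complement of $k + l$, which is again
  a codeword, has weight less than $d$; then $k$ and $l$ are complementary and the two words are
  matched already. The orbits of ordered pairs have $|L|$ elements each, and $|L| \ge 2^{n (1 - H(d/n))}$
  by the Gilbert-Varshamov bound. Chernoff bounds without polynomial factors show that both $o(1)$
  terms can be taken to be $0$.
\<close>

section \<open>Linear codes\<close>

definition linear_code :: "'i set \<Rightarrow> nat \<Rightarrow> 'i set set \<Rightarrow> bool" where
  "linear_code I d L \<longleftrightarrow>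
     L \<subseteq> Pow I \<and> {} \<in> L \<and> I \<in> L \<and> (\<forall>k\<in>L. \<forall>l\<in>L. sym_diff k l \<in> L) \<and>
     (\<forall>l\<in>L. l \<noteq> {} \<longrightarrow> d \<le> card l)"

text \<open>Addition is its own inverse, so the span of \<open>L\<close> and \<open>v\<close> is
  just \<open>L\<close> and the coset of \<open>v\<close>. The weight of \<open>sym_diff v l\<close>
  is the distance from \<open>v\<close> to \<open>l\<close>, so \<open>far\<close> is the weight
  condition on the coset.\<close>

lemma linear_code_extend:
  assumes L: "linear_code I d L" and v: "v \<subseteq> I"
    and far: "\<And>l. l \<in> L \<Longrightarrow> d \<le> card (sym_diff v l)"
  shows "linear_code I d (L \<union> sym_diff v ` L)"
proof -
  have cl: "sym_diff k l \<in> L" if "k \<in> L" "l \<in> L" for k l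
    using L that unfolding linear_code_def by blast
  have c1: "sym_diff k (sym_diff v l) \<in> sym_diff v ` L" if "k \<in> L" "l \<in> L" for k l
    by (rule image_eqI[OF _ cl[OF that]]) blast
  have c2: "sym_diff (sym_diff v k) l \<in> sym_diff v ` L" if "k \<in> L" "l \<in> L" for k l
    by (rule image_eqI[OF _ cl[OF that]]) blast
  have "sym_diff (sym_diff v k) (sym_diff v l) = sym_diff k l" for k l by blast
  then have c3: "sym_diff (sym_diff v k) (sym_diff v l) \<in> L" if "k \<in> L" "l \<in> L" for k l
    using cl[OF that] by (simp only:)
  have sum: "sym_diff a b \<in> L \<union> sym_diff v ` L"
    if ab: "a \<in> L \<union> sym_diff v ` L" "b \<in> L \<union> sym_diff v ` L" for a b
  proof -
    consider "a \<in> L" "b \<in> L" | l where "a \<in> L" "l \<in> L" "b = sym_diff v l"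
      | k where "k \<in> L" "b \<in> L" "a = sym_diff v k"
      | k l where "k \<in> L" "l \<in> L" "a = sym_diff v k" "b = sym_diff v l"
      using ab by (elim UnE imageE) (rule that; assumption)+
    then show ?thesis
    proof cases
      case 1 then show ?thesis by (intro UnI1) (rule cl)
    next
      case 2 then show ?thesis by (intro UnI2) (simp only: c1)
    next
      case 3 then show ?thesis by (intro UnI2) (simp only: c2)
    next
      case 4 then show ?thesis by (intro UnI1) (simp only: c3)
    qed
  qed
  have "\<forall>l\<in>L \<union> sym_diff v ` L. l \<noteq> {} \<longrightarrow> d \<le> card l"
    unfolding ball_Un
  proof
    show "\<forall>l\<in>L. l \<noteq> {} \<longrightarrow> d \<le> card l" using L by (simp add: linear_code_def)
    show "\<forall>l\<in>sym_diff v ` L. l \<noteq> {} \<longrightarrow> d \<le> card l"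
      by (intro ballI impI, erule imageE) (simp only: far)
  qed
  moreover have "L \<union> sym_diff v ` L \<subseteq> Pow I" "{} \<in> L \<union> sym_diff v ` L" "I \<in> L \<union> sym_diff v ` L"
    using L v by (auto simp: linear_code_def)
  ultimately show ?thesis
    unfolding linear_code_def by (intro conjI) (assumption | intro ballI sum)+
qed

text \<open>A maximal code has every word within distance less than \<open>d\<close>, so the balls
  around its codewords cover \<open>Pow I\<close>; comparing sizes gives the bound.\<close>

lemma gilbert_varshamov:
  assumes fin: "finite I" and d: "0 < d" "d \<le> card I"
  shows "\<exists>L. linear_code I d L \<and> 2 ^ card I \<le> card L * card {S \<in> Pow I. card S < d}"
proof -
  let ?codes = "{L. linear_code I d L}"
  have sub: "?codes \<subseteq> Pow (Pow I)" unfolding linear_code_def by blast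
  then have fin_codes: "finite ?codes" using fin by (meson finite_Pow_iff finite_subset)
  \<comment> \<open>The repetition code shows that there is a code to start from; its only nonempty
    word has weight \<open>card I\<close>.\<close>
  have "linear_code I d {{}, I}" using d unfolding linear_code_def by auto
  then obtain L where L: "linear_code I d L" and max: "\<And>K. linear_code I d K \<Longrightarrow> L \<subseteq> K \<Longrightarrow> K = L"
    using finite_has_maximal[OF fin_codes] by (metis empty_iff mem_Collect_eq)
  have LI: "L \<subseteq> Pow I" and eL: "{} \<in> L" using L unfolding linear_code_def by blast+
  let ?B = "{S \<in> Pow I. card S < d}"
  have "Pow I \<subseteq> (\<lambda>(l, S). sym_diff l S) ` (L \<times> ?B)"
  proof
    fix v assume v: "v \<in> Pow I"
    show "v \<in> (\<lambda>(l, S). sym_diff l S) ` (L \<times> ?B)"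
    proof (cases "\<exists>l\<in>L. card (sym_diff v l) < d")
      case True
      then obtain l where l: "l \<in> L" "card (sym_diff v l) < d" by blast
      have "v = sym_diff l (sym_diff v l)" by blast
      moreover have "sym_diff v l \<in> ?B" using l v LI by blast
      ultimately show ?thesis using l(1) by (auto intro!: image_eqI[of _ _ "(l, sym_diff v l)"])
    next
      case False
      \<comment> \<open>A word far from all of \<open>L\<close> would enlarge the code, so
        maximality puts it into \<open>L\<close>, where it is its own centre with error
        \<open>{}\<close>.\<close>
      then have "linear_code I d (L \<union> sym_diff v ` L)"
        using v by (intro linear_code_extend[OF L]) auto
      from max[OF this] have "sym_diff v {} \<in> L" using eL by blast
      then have "v \<in> L" by simp
      moreover have "{} \<in> ?B" using d by simp
      ultimately show ?thesis by (auto intro!: image_eqI[of _ _ "(v, {})"])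
    qed
  qed
  moreover have "finite (L \<times> ?B)"
    using fin finite_subset[OF LI] by simp
  ultimately have "card (Pow I) \<le> card (L \<times> ?B)"
    by (meson card_image_le card_mono finite_imageI le_trans)
  then show ?thesis using L fin by (auto simp: card_Pow card_cartesian_product)
qed

section \<open>The code graph\<close>

definition agreement :: "'i set \<Rightarrow> ('i \<Rightarrow> 'c) \<times> ('i \<Rightarrow> 'c) \<Rightarrow> 'i set" where
  "agreement I p = {i \<in> I. fst p i = snd p i}"

definition swap_on :: "'i set \<Rightarrow> ('i \<Rightarrow> 'c) \<times> ('i \<Rightarrow> 'c) \<Rightarrow> ('i \<Rightarrow> 'c) \<times> ('i \<Rightarrow> 'c)" where
  "swap_on l p = (override_on (fst p) (snd p) l, override_on (snd p) (fst p) l)"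

definition edge_of :: "'a \<times> 'a \<Rightarrow> 'a set" where
  "edge_of p = {fst p, snd p}"

lemma edge_of_eq_iff: "edge_of p = edge_of q \<longleftrightarrow> p = q \<or> p = prod.swap q"
  by (cases p; cases q) (auto simp: edge_of_def doubleton_eq_iff)

text \<open>Two swaps at the same position cancel, so sets under \<open>sym_diff\<close> act as a
  group on pairs.\<close>

lemma swap_on_swap_on: "swap_on k (swap_on l p) = swap_on (sym_diff k l) p"
  by (auto simp: swap_on_def override_on_def fun_eq_iff)

lemma swap_on_empty [simp]: "swap_on {} p = p"
  by (simp add: swap_on_def)

lemma agreement_swap_on: "agreement I (swap_on l p) = agreement I p"
  by (auto simp: agreement_def swap_on_def override_on_def)

locale code_graph =
  fixes I :: "'i set" and Q :: "'c set" and d :: nat and L :: "'i set set"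
  assumes finite_I: "finite I" and finite_Q: "finite Q" and code: "linear_code I d L"
    and d_le: "d \<le> card I"
begin

abbreviation "words \<equiv> I \<rightarrow>\<^sub>E Q"

text \<open>Edges are kept as ordered pairs because the action needs to know which word comes first;
  each edge gives two arcs, one in each direction.\<close>

definition "arcs = {p \<in> words \<times> words. card (agreement I p) < d}"

definition "orbit p = (\<lambda>l. swap_on l p) ` L"

definition "edges = edge_of ` arcs"

definition "matchings = (\<lambda>p. edge_of ` orbit p) ` arcs"

lemma L_sub: "l \<in> L \<Longrightarrow> l \<subseteq> I" and empty_L: "{} \<in> L" and full_L: "I \<in> L"
  and sym_diff_L: "k \<in> L \<Longrightarrow> l \<in> L \<Longrightarrow> sym_diff k l \<in> L"
  and weight_L: "l \<in> L \<Longrightarrow> card l < d \<Longrightarrow> l = {}"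
  using code unfolding linear_code_def by (blast, simp, simp, simp, force)

lemma finite_L: "finite L"
  using L_sub finite_I by (intro finite_subset[of L "Pow I"]) auto

lemma finite_words: "finite words"
  using finite_I finite_Q by (intro finite_PiE) auto

lemma finite_arcs: "finite arcs"
  using finite_words unfolding arcs_def by auto

lemma swap_on_arcs: "p \<in> arcs \<Longrightarrow> l \<in> L \<Longrightarrow> swap_on l p \<in> arcs"
  using L_sub[of l]
  by (auto simp: arcs_def agreement_swap_on)
     (auto simp: swap_on_def override_on_def PiE_iff extensional_def)

text \<open>Words are extensional and hence coincide outside \<open>I\<close>, so swapping on
  \<open>I\<close> exchanges them entirely: the all-ones codeword reverses arcs.\<close>

lemma swap_on_full:
  assumes "p \<in> arcs"
  shows "swap_on I p = prod.swap p"
proof -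
  have "fst p i = snd p i" if "i \<notin> I" for i
  proof -
    have "fst p \<in> words" "snd p \<in> words" using assms by (auto simp: arcs_def)
    then show ?thesis using PiE_arb that by metis
  qed
  then have "override_on (fst p) (snd p) I = snd p" "override_on (snd p) (fst p) I = fst p"
    by (auto simp: override_on_def fun_eq_iff)
  then show ?thesis
    by (simp add: swap_on_def prod_eq_iff)
qed

text \<open>The agreement set of an arc has fewer than \<open>d\<close> positions, too few for a
  nonempty codeword.\<close>

lemma agreement_arcs: "p \<in> arcs \<Longrightarrow> k \<in> L \<Longrightarrow> k \<subseteq> agreement I p \<Longrightarrow> k = {}"
  using weight_L[of k] card_mono[of "agreement I p" k] finite_I
  by (auto simp: arcs_def agreement_def)

text \<open>Where exactly one of \<open>k\<close> and \<open>l\<close> swaps, equal first components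
  force the two words of \<open>p\<close> to agree, so the codeword \<open>sym_diff k l\<close> lies
  in the agreement set. This yields both the size of an orbit and the disjointness of its
  edges.\<close>

lemma fst_swap_on_inj:
  assumes "p \<in> arcs" "k \<in> L" "l \<in> L" "fst (swap_on k p) = fst (swap_on l p)"
  shows "k = l"
proof -
  have "fst p i = snd p i" if "i \<in> sym_diff k l" for i
    using that fun_cong[OF assms(4), of i] by (auto simp: swap_on_def override_on_def)
  then have "sym_diff k l \<subseteq> agreement I p"
    using L_sub assms by (auto simp: agreement_def)
  with agreement_arcs[OF assms(1) sym_diff_L[OF assms(2,3)]] show ?thesis by blast
qed

text \<open>A word agrees with itself in all \<open>card I\<close> positions, which is at least
  \<open>d\<close>.\<close>

lemma arcs_neq: "p \<in> arcs \<Longrightarrow> fst p \<noteq> snd p"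
  using d_le by (auto simp: arcs_def agreement_def)

lemma orbit_eq:
  assumes "q \<in> orbit p"
  shows "orbit q = orbit p"
proof -
  obtain k where k: "k \<in> L" "q = swap_on k p" using assms by (auto simp: orbit_def)
  have "swap_on l p = swap_on (sym_diff l k) q" for l
    unfolding k swap_on_swap_on by (rule arg_cong[where f = "\<lambda>s. swap_on s p"]) blast
  then have "swap_on l p \<in> orbit q" "swap_on l q \<in> orbit p" if "l \<in> L" for l
    unfolding orbit_def using sym_diff_L[OF that k(1)] k(2) swap_on_swap_on by blast+
  then show ?thesis
    unfolding orbit_def by blast
qed

lemma orbit_arcs: "p \<in> arcs \<Longrightarrow> q \<in> orbit p \<Longrightarrow> q \<in> arcs"
  unfolding orbit_def by (erule imageE) (simp add: swap_on_arcs)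

lemma self_orbit: "p \<in> orbit p"
  unfolding orbit_def by (rule image_eqI[OF _ empty_L]) simp

text \<open>Reversal is the action of the codeword \<open>I\<close>. Closure under it lets later
  arguments look at first components only.\<close>

lemma swap_orbit:
  assumes "p \<in> arcs" "q \<in> orbit p"
  shows "prod.swap q \<in> orbit p"
proof -
  have "swap_on I q \<in> orbit q" unfolding orbit_def by (rule imageI[OF full_L])
  then show ?thesis
    unfolding swap_on_full[OF orbit_arcs[OF assms]] orbit_eq[OF assms(2)] .
qed

lemma orbit_fst_inj:
  assumes "p \<in> arcs" "q \<in> orbit p" "r \<in> orbit p" "fst q = fst r"
  shows "q = r"
proof -
  obtain k l where "k \<in> L" "l \<in> L" "q = swap_on k p" "r = swap_on l p"
    using assms(2,3) unfolding orbit_def by blast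
  then show ?thesis using fst_swap_on_inj[OF assms(1)] assms(4) by blast
qed

lemma card_orbit: "p \<in> arcs \<Longrightarrow> card (orbit p) = card L"
  unfolding orbit_def by (intro card_image inj_onI) (simp add: fst_swap_on_inj)

lemma finite_orbit: "finite (orbit p)"
  by (simp add: orbit_def finite_L)

lemma matching_vertexE:
  assumes "p \<in> arcs" "a \<in> \<Union>(edge_of ` orbit p)"
  obtains q where "q \<in> orbit p" "a = fst q"
proof -
  obtain q where q: "q \<in> orbit p" "a = fst q \<or> a = snd q"
    using assms(2) unfolding edge_of_def by blast
  then show thesis
    using that[of q] that[of "prod.swap q"] swap_orbit[OF assms(1) q(1)] by auto
qed

lemma orbit_induced:
  assumes p: "p \<in> arcs" and qr: "q \<in> orbit p" "r \<in> orbit p" and e: "(fst q, fst r) \<in> arcs"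
  shows "r = prod.swap q"
proof -
  obtain k l where kl: "k \<in> L" "l \<in> L" "q = swap_on k p" "r = swap_on l p"
    using qr by (auto simp: orbit_def)
  \<comment> \<open>Outside \<open>sym_diff k l\<close> both first components are read off the same
    component of \<open>p\<close>.\<close>
  have "I - sym_diff k l \<subseteq> agreement I (fst q, fst r)"
    by (auto simp: kl agreement_def swap_on_def override_on_def)
  moreover have "sym_diff I (sym_diff k l) = I - sym_diff k l"
    using L_sub kl by blast
  ultimately have "I - sym_diff k l = {}"
    using agreement_arcs[OF e] sym_diff_L[OF full_L sym_diff_L[OF kl(1,2)]] by metis
  then have "l = sym_diff I k" using L_sub kl by blast
  then have "r = swap_on I q" by (simp add: kl swap_on_swap_on)
  then show ?thesis using swap_on_full orbit_arcs[OF p qr(1)] by simp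
qed

lemma induced_matching_orbit:
  assumes p: "p \<in> arcs"
  shows "induced_matching edges (edge_of ` orbit p)"
  unfolding induced_matching_def
proof (intro conjI)
  show sub: "edge_of ` orbit p \<subseteq> edges"
    using orbit_arcs[OF p] by (auto simp: edges_def)
  show "pairwise disjnt (edge_of ` orbit p)"
  proof (intro pairwiseI, rule ccontr)
    fix e f assume ef: "e \<in> edge_of ` orbit p" "f \<in> edge_of ` orbit p" "e \<noteq> f" "\<not> disjnt e f"
    then obtain a where a: "a \<in> e" "a \<in> f" by (auto simp: disjnt_def)
    \<comment> \<open>After a reversal if necessary, the shared vertex \<open>a\<close> comes first
      in the arcs of both edges, and then \<open>orbit_fst_inj\<close> identifies these
      arcs.\<close>
    have *: "\<exists>q \<in> orbit p. g = edge_of q \<and> a = fst q" if "g \<in> edge_of ` orbit p" "a \<in> g" for g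
    proof -
      obtain q where q: "q \<in> orbit p" "g = edge_of q" using \<open>g \<in> _\<close> by blast
      then have "a = fst q \<or> a = fst (prod.swap q)" using \<open>a \<in> g\<close> by (auto simp: edge_of_def)
      then show ?thesis using q swap_orbit[OF p q(1)] edge_of_eq_iff by metis
    qed
    show False
      using *[OF ef(1) a(1)] *[OF ef(2) a(2)] orbit_fst_inj[OF p] ef(3) by metis
  qed
  show "induced_edges edges (\<Union>(edge_of ` orbit p)) = edge_of ` orbit p"
  proof
    show "edge_of ` orbit p \<subseteq> induced_edges edges (\<Union>(edge_of ` orbit p))"
      using sub by (auto simp: induced_edges_def)
    show "induced_edges edges (\<Union>(edge_of ` orbit p)) \<subseteq> edge_of ` orbit p"
    proof
      fix e assume "e \<in> induced_edges edges (\<Union>(edge_of ` orbit p))"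
      then obtain s where s: "s \<in> arcs" "e = edge_of s" and
        "fst s \<in> \<Union>(edge_of ` orbit p)" "snd s \<in> \<Union>(edge_of ` orbit p)"
        by (auto simp: induced_edges_def edges_def edge_of_def)
      then obtain q r where qr: "q \<in> orbit p" "r \<in> orbit p" "fst s = fst q" "snd s = fst r"
        using matching_vertexE[OF p] by metis
      then have "s = (fst q, fst r)" by (simp add: prod_eq_iff)
      \<comment> \<open>Here \<open>r\<close> is the reversal of \<open>q\<close>, so
        \<open>fst r\<close> is \<open>snd q\<close>.\<close>
      with orbit_induced[OF p qr(1,2)] s have "s = q" by auto
      then show "e \<in> edge_of ` orbit p" using qr s by blast
    qed
  qed
qed

lemma matchings_cover: "disjoint_induced_matching_cover edges matchings"
  unfolding disjoint_induced_matching_cover_def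
proof (intro conjI ballI)
  show "finite matchings" by (simp add: matchings_def finite_arcs)
  show "induced_matching edges M" if "M \<in> matchings" for M
    using that induced_matching_orbit by (auto simp: matchings_def)
  show "\<Union>matchings = edges"
    unfolding matchings_def edges_def using orbit_arcs self_orbit by blast
  show "pairwise disjnt matchings"
  proof (intro pairwiseI, rule ccontr)
    fix M N assume MN: "M \<in> matchings" "N \<in> matchings" "M \<noteq> N" "\<not> disjnt M N"
    then obtain p q where pq: "p \<in> arcs" "q \<in> arcs" "M = edge_of ` orbit p" "N = edge_of ` orbit q"
      unfolding matchings_def by blast
    obtain e where "e \<in> M" "e \<in> N" using MN(4) unfolding disjnt_def by blast
    then obtain r s where "r \<in> orbit p" "s \<in> orbit q" "edge_of r = edge_of s"
      unfolding pq(3,4) by blast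
    \<comment> \<open>Arcs with the same edge are equal up to reversal, and reversal does not leave
      the orbit.\<close>
    then have "r \<in> orbit q" using swap_orbit[OF pq(2)] unfolding edge_of_eq_iff by blast
    then have "orbit p = orbit q" using orbit_eq \<open>r \<in> orbit p\<close> by metis
    then show False using pq MN by simp
  qed
qed

text \<open>The orbits of arcs are disjoint sets of ordered pairs of words, each of size
  \<open>card L\<close>, and every matching is the image of an orbit.\<close>

lemma card_matchings: "card matchings * card L \<le> card words ^ 2"
proof -
  have "card L * card (orbit ` arcs) = card (\<Union>(orbit ` arcs))"
  proof (rule card_partition)
    show "c1 \<inter> c2 = {}" if c: "c1 \<in> orbit ` arcs" "c2 \<in> orbit ` arcs" "c1 \<noteq> c2" for c1 c2
    proof (rule ccontr)
      assume "c1 \<inter> c2 \<noteq> {}"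
      then obtain q where "q \<in> c1" "q \<in> c2" by blast
      then have "orbit q = c1" "orbit q = c2" using c(1,2) orbit_eq by blast+
      then show False using c(3) by simp
    qed
  qed (auto simp: finite_arcs finite_orbit card_orbit)
  also have "\<dots> \<le> card (words \<times> words)"
  proof (rule card_mono)
    have "\<Union>(orbit ` arcs) \<subseteq> arcs"
      by (intro UN_least subsetI) (rule orbit_arcs)
    then show "\<Union>(orbit ` arcs) \<subseteq> words \<times> words"
      unfolding arcs_def by blast
  qed (simp add: finite_words)
  also have "\<dots> = card words ^ 2"
    by (simp add: card_cartesian_product power2_eq_square)
  finally have total: "card L * card (orbit ` arcs) \<le> card words ^ 2" .
  have "card matchings \<le> card (orbit ` arcs)"
    unfolding matchings_def image_image[of "image edge_of" orbit, symmetric]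
    by (intro card_image_le) (simp add: finite_arcs)
  then have "card L * card matchings \<le> card L * card (orbit ` arcs)"
    by (rule mult_le_mono2)
  from order_trans[OF this total] show ?thesis by (simp only: mult.commute)
qed

lemma simple_graph_edges: "simple_graph words edges"
  unfolding simple_graph_def
proof (intro conjI ballI)
  fix e assume "e \<in> edges"
  then obtain p where p: "p \<in> arcs" "e = edge_of p" by (auto simp: edges_def)
  then show "e \<subseteq> words" by (auto simp: edge_of_def arcs_def)
  show "card e = 2" using p arcs_neq by (simp add: edge_of_def)
qed (rule finite_words)

text \<open>Each missing edge comes from an ordered pair with at least \<open>d\<close> agreements,
  and \<open>b\<close> bounds the number of such partners of one word. The diagonal and both orders
  are counted too, which only weakens the bound.\<close>

lemma card_missing:
  assumes "\<And>x. x \<in> words \<Longrightarrow> card {y \<in> words. d \<le> card (agreement I (x, y))} \<le> b"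
  shows "card words choose 2 \<le> card edges + card words * b"
proof -
  let ?far = "SIGMA x:words. {y \<in> words. d \<le> card (agreement I (x, y))}"
  have fin: "finite ?far" using finite_words by auto
  have "{e. e \<subseteq> words \<and> card e = 2} \<subseteq> edges \<union> edge_of ` ?far"
  proof
    fix e assume "e \<in> {e. e \<subseteq> words \<and> card e = 2}"
    then obtain x y where e: "e = edge_of (x, y)" "x \<in> words" "y \<in> words"
      by (auto simp: card_2_iff edge_of_def)
    show "e \<in> edges \<union> edge_of ` ?far"
    proof (cases "card (agreement I (x, y)) < d")
      case True
      then have "(x, y) \<in> arcs" using e by (simp add: arcs_def)
      then show ?thesis using e by (auto simp: edges_def)
    next
      case False
      then have "(x, y) \<in> ?far" using e by auto
      then show ?thesis using e by blast
    qed
  qed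
  then have "card {e. e \<subseteq> words \<and> card e = 2} \<le> card (edges \<union> edge_of ` ?far)"
    using fin finite_arcs by (intro card_mono) (auto simp: edges_def)
  also have "\<dots> \<le> card edges + card ?far"
    by (rule order_trans[OF card_Un_le add_left_mono[OF card_image_le[OF fin]]])
  also have "card ?far = (\<Sum>x\<in>words. card {y \<in> words. d \<le> card (agreement I (x, y))})"
    using finite_words by simp
  also have "\<dots> \<le> card words * b"
    using sum_bounded_above[of words _ b] assms by simp
  finally show ?thesis by (simp add: n_subsets finite_words)
qed

end

section \<open>Chernoff bounds\<close>

text \<open>Markov's inequality for the exponential moment of \<open>f\<close>. The assumption on
  \<open>P\<close> covers the lower tail with \<open>w \<le> 1\<close> and the upper tail with
  \<open>w \<ge> 1\<close>.\<close>

lemma card_exponential_bound: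
  fixes w :: real
  assumes "finite A" "0 < w" and "\<And>a. a \<in> A \<Longrightarrow> P a \<Longrightarrow> w ^ d \<le> w ^ f a"
  shows "real (card {a \<in> A. P a}) * w ^ d \<le> (\<Sum>a\<in>A. w ^ f a)"
proof -
  have "real (card {a \<in> A. P a}) * w ^ d = (\<Sum>a | a \<in> A \<and> P a. w ^ d)" by simp
  also have "\<dots> \<le> (\<Sum>a | a \<in> A \<and> P a. w ^ f a)" using assms by (intro sum_mono) auto
  also have "\<dots> \<le> (\<Sum>a\<in>A. w ^ f a)" using assms by (intro sum_mono2) auto
  finally show ?thesis .
qed

text \<open>The generating function of the subsets of \<open>I\<close> by size is
  \<open>(1 + w) ^ card I\<close>.\<close>

lemma card_small_subsets:
  fixes w :: real
  assumes "finite I" "0 < w" "w \<le> 1"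
  shows "real (card {S \<in> Pow I. card S < d}) * w ^ d \<le> (1 + w) ^ card I"
proof -
  have "real (card {S \<in> Pow I. card S < d}) * w ^ d \<le> (\<Sum>S\<in>Pow I. w ^ card S)"
    using assms by (intro card_exponential_bound) (auto intro: power_decreasing)
  also have "\<dots> = (1 + w) ^ card I"
    using prod_add[OF assms(1), of "\<lambda>_. w" "\<lambda>_. 1"] by (simp add: add.commute)
  finally show ?thesis .
qed

text \<open>The generating function of the agreements with \<open>x\<close> factorises over
  positions: the letter of \<open>x\<close> contributes \<open>w\<close>, each other letter
  contributes 1.\<close>

lemma card_large_agreement:
  fixes w :: real
  assumes "finite I" "finite Q" "1 \<le> w" "x \<in> I \<rightarrow>\<^sub>E Q"
  shows "real (card {y \<in> I \<rightarrow>\<^sub>E Q. d \<le> card (agreement I (x, y))}) * w ^ d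
           \<le> (w + (real (card Q) - 1)) ^ card I"
proof -
  have "real (card {y \<in> I \<rightarrow>\<^sub>E Q. d \<le> card (agreement I (x, y))}) * w ^ d
          \<le> (\<Sum>y\<in>I \<rightarrow>\<^sub>E Q. w ^ card (agreement I (x, y)))"
    using assms by (intro card_exponential_bound finite_PiE) (auto intro: power_increasing)
  also have "\<dots> = (\<Sum>y\<in>I \<rightarrow>\<^sub>E Q. \<Prod>i\<in>I. if x i = y i then w else 1)"
    using assms(1) by (intro sum.cong refl)
      (simp add: agreement_def prod.If_cases Int_def)
  also have "\<dots> = (\<Prod>i\<in>I. \<Sum>c\<in>Q. if x i = c then w else 1)"
    using assms by (intro prod_sum_PiE[symmetric]) auto
  also have "\<dots> = (\<Prod>i\<in>I. w + (real (card Q) - 1))"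
  proof (rule prod.cong[OF refl])
    fix i assume "i \<in> I"
    then have "x i \<in> Q" using assms by auto
    then have "card Q > 0" using assms by (auto simp: card_gt_0_iff)
    have "(\<Sum>c\<in>Q. if x i = c then w else 1)
            = w + (\<Sum>c\<in>Q - {x i}. if x i = c then w else 1)"
      using assms \<open>x i \<in> Q\<close> by (subst sum.remove[of _ "x i"]) auto
    also have "(\<Sum>c\<in>Q - {x i}. if x i = c then w else 1) = (\<Sum>c\<in>Q - {x i}. 1)"
      by (intro sum.cong) auto
    also have "\<dots> = real (card Q) - 1"
      using assms \<open>x i \<in> Q\<close> \<open>card Q > 0\<close> by (simp add: of_nat_diff)
    finally show "(\<Sum>c\<in>Q. if x i = c then w else 1) = w + (real (card Q) - 1)" .
  qed
  finally show ?thesis by simp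
qed

text \<open>The product \<open>p ^ d * (1 - p) ^ (n - d)\<close> is the probability of a fixed word
  with \<open>d\<close> ones under independent bits of bias \<open>p\<close>. Written as a product
  equal to 1, the identity can be inserted into an estimate and cancelled.\<close>

lemma powr_entropy:
  assumes "0 < d" "d < n"
  defines "p \<equiv> real d / real n"
  shows "2 powr (real n * binary_entropy p) * (p ^ d * (1 - p) ^ (n - d)) = 1"
proof -
  have p: "0 < p" "p < 1" using assms by (auto simp: p_def)
  have n: "real n * p = real d" "real n * (1 - p) = real (n - d)"
    using assms by (auto simp: p_def field_simps of_nat_diff)
  have "real n * binary_entropy p
      = - (real n * p) * log 2 p - (real n * (1 - p)) * log 2 (1 - p)"
    by (simp add: binary_entropy_def algebra_simps)
  also have "\<dots> = - (real d * log 2 p + real (n - d) * log 2 (1 - p))"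
    unfolding n by simp
  also have "\<dots> = - log 2 (p ^ d * (1 - p) ^ (n - d))"
    using p by (simp add: log_mult log_nat_power)
  finally show ?thesis
    using p by (simp add: powr_minus field_simps)
qed

text \<open>At the optimal weight, \<open>(1 + w) ^ n / w ^ d\<close> is exactly the entropy power.
  The condition \<open>2 * d \<le> n\<close> makes this weight at most 1, as the lower tail
  demands.\<close>

lemma card_small_subsets_entropy:
  assumes "finite I" "card I = n" "0 < d" "2 * d \<le> n"
  shows "real (card {S \<in> Pow I. card S < d}) \<le> 2 powr (real n * binary_entropy (real d / real n))"
proof -
  define p where "p = real d / real n"
  \<comment> \<open>the weight that minimises $(1 + w)^n / w^d$\<close>
  define w where "w = p / (1 - p)"
  have p: "0 < p" "p \<le> 1 / 2" "d < n" using assms by (auto simp: p_def field_simps)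
  have w: "0 < w" "w \<le> 1" "1 + w = 1 / (1 - p)" using p by (auto simp: w_def field_simps)
  \<comment> \<open>The factor \<open>(1 - p) ^ n\<close> clears denominators and turns
    \<open>(1 + w) ^ n\<close> into 1.\<close>
  have eq: "w ^ d * (1 - p) ^ n = p ^ d * (1 - p) ^ (n - d)"
    using p by (simp add: w_def power_divide power_diff field_simps)
  have "real (card {S \<in> Pow I. card S < d}) * w ^ d * (1 - p) ^ n \<le> (1 + w) ^ n * (1 - p) ^ n"
    using card_small_subsets[OF assms(1) w(1,2), of d] p assms by (intro mult_right_mono) auto
  also have "\<dots> = 1" using p w by (simp flip: power_mult_distrib)
  also have "\<dots> = 2 powr (real n * binary_entropy p) * (p ^ d * (1 - p) ^ (n - d))"
    using powr_entropy[OF assms(3) p(3)] by (simp add: p_def)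
  finally have "real (card {S \<in> Pow I. card S < d}) * (p ^ d * (1 - p) ^ (n - d))
      \<le> 2 powr (real n * binary_entropy p) * (p ^ d * (1 - p) ^ (n - d))"
    unfolding eq[symmetric] by (simp add: mult.assoc)
  then show ?thesis using p by (simp add: p_def)
qed

text \<open>The optimal weight is at least 1 exactly when \<open>d\<close> is at least
  \<open>n / card Q\<close>, the mean number of agreements with a uniformly random word; this is the
  assumption on \<open>real n\<close>.\<close>

lemma card_large_agreement_entropy:
  assumes "finite I" "card I = n" "finite Q" "0 < d" "d < n" "2 \<le> card Q"
    and "real n \<le> real d * real (card Q)" and "x \<in> I \<rightarrow>\<^sub>E Q"
  shows "real (card {y \<in> I \<rightarrow>\<^sub>E Q. d \<le> card (agreement I (x, y))})
     \<le> 2 powr (real n * binary_entropy (real d / real n)) * (real (card Q) - 1) ^ (n - d)"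
proof -
  define p where "p = real d / real n"
  define m where "m = real (card Q) - 1"
  \<comment> \<open>the weight that minimises $(w + m)^n / w^d$\<close>
  define w where "w = p * m / (1 - p)"
  have p: "0 < p" "p < 1" "1 \<le> p * (m + 1)" and m: "0 < m"
    using assms by (auto simp: p_def m_def field_simps)
  have w: "1 \<le> w" "(w + m) * (1 - p) = m" using p by (auto simp: w_def field_simps)
  let ?X = "real (card {y \<in> I \<rightarrow>\<^sub>E Q. d \<le> card (agreement I (x, y))})"
  have eq: "w ^ d * (1 - p) ^ n = (p ^ d * (1 - p) ^ (n - d)) * m ^ d"
    using p assms(5) by (simp add: w_def power_divide power_mult_distrib power_diff field_simps)
  have "?X * w ^ d * (1 - p) ^ n \<le> (w + m) ^ n * (1 - p) ^ n"
    using card_large_agreement[OF assms(1,3) w(1) assms(8), of d] p assms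
    by (intro mult_right_mono) (auto simp: m_def)
  also have "\<dots> = m ^ n" using w by (simp flip: power_mult_distrib)
  \<comment> \<open>The factor \<open>m ^ d\<close> is split off to cancel the one that
    \<open>w ^ d\<close> contributes in \<open>eq\<close>.\<close>
  also have "\<dots> = m ^ (n - d) * m ^ d" using assms by (simp flip: power_add)
  also have "\<dots> = 2 powr (real n * binary_entropy p) * (p ^ d * (1 - p) ^ (n - d)) * (m ^ (n - d) * m ^ d)"
    using powr_entropy[OF assms(4,5)] by (simp add: p_def)
  finally have "?X * (w ^ d * (1 - p) ^ n)
      \<le> 2 powr (real n * binary_entropy p) * m ^ (n - d) * (p ^ d * (1 - p) ^ (n - d) * m ^ d)"
    by (simp add: mult_ac)
  then have "?X * (p ^ d * (1 - p) ^ (n - d) * m ^ d)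
      \<le> 2 powr (real n * binary_entropy p) * m ^ (n - d) * (p ^ d * (1 - p) ^ (n - d) * m ^ d)"
    by (simp only: eq)
  then have "?X \<le> 2 powr (real n * binary_entropy p) * m ^ (n - d)"
    by (rule mult_right_le_imp_le) (use p m in simp)
  then show ?thesis by (simp add: p_def m_def)
qed

section \<open>Relabelling the vertices\<close>

lemma induced_matching_image:
  assumes f: "inj_on f V" and E: "E \<subseteq> Pow V" and M: "induced_matching E M"
  shows "induced_matching (image f ` E) (image f ` M)"
proof -
  have ME: "M \<subseteq> E" and MV: "M \<subseteq> Pow V" and UV: "\<Union>M \<subseteq> V"
    using M E by (auto simp: induced_matching_def)
  have "disjnt (f ` a) (f ` b)" if "a \<in> M" "b \<in> M" "a \<noteq> b" for a b
  proof -
    have "a \<inter> b = {}" using M that by (auto simp: induced_matching_def pairwise_def disjnt_def)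
    then show ?thesis using inj_on_image_Int[OF f, of a b] MV that by (auto simp: disjnt_def)
  qed
  then have "pairwise disjnt (image f ` M)"
    by (auto simp: pairwise_def)
  moreover have "e \<in> M" if "e \<in> E" "f ` e \<subseteq> \<Union>(image f ` M)" for e
  proof -
    \<comment> \<open>Injectivity on \<open>V\<close> pulls the inclusion of images back, so no new
      edge becomes induced.\<close>
    have "e \<subseteq> \<Union>M"
    proof
      fix x assume "x \<in> e"
      then obtain y where "y \<in> \<Union>M" "f x = f y" using \<open>f ` e \<subseteq> _\<close> by blast
      moreover have "x \<in> V" using \<open>x \<in> e\<close> \<open>e \<in> E\<close> E by blast
      ultimately show "x \<in> \<Union>M" using inj_onD[OF f] UV by blast
    qed
    then show ?thesis using M that by (auto simp: induced_matching_def induced_edges_def)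
  qed
  ultimately show ?thesis
    using ME by (auto simp: induced_matching_def induced_edges_def)
qed

text \<open>The words are functions, whereas the theorem asks for natural numbers as
  vertices.\<close>

lemma relabel_to_nat:
  assumes G: "simple_graph V E" and MM: "disjoint_induced_matching_cover E MM"
  shows "\<exists>(V' :: nat set) E' MM'. simple_graph V' E' \<and> card V' = card V \<and> card E' = card E \<and>
           disjoint_induced_matching_cover E' MM' \<and> card MM' \<le> card MM"
proof -
  have fin: "finite V" and E: "E \<subseteq> Pow V" using G by (auto simp: simple_graph_def)
  obtain f :: "_ \<Rightarrow> nat" where f: "inj_on f V"
    using finite_imp_inj_to_nat_seg[OF fin] by blast
  have fP: "inj_on (image f) E"
    using inj_on_image_Pow[OF f] E by (rule inj_on_subset)
  have sub: "M \<subseteq> E" if "M \<in> MM" for M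
    using MM that by (auto simp: disjoint_induced_matching_cover_def)
  have "simple_graph (f ` V) (image f ` E)"
    unfolding simple_graph_def
  proof (intro conjI ballI)
    fix e assume "e \<in> image f ` E"
    then obtain e' where e': "e' \<in> E" "e = f ` e'" by blast
    then have "inj_on f e'" using f E by (meson PowD inj_on_subset subsetD)
    then show "e \<subseteq> f ` V" "card e = 2"
      using e' G by (auto simp: card_image simple_graph_def)
  qed (simp add: fin)
  moreover have "disjoint_induced_matching_cover (image f ` E) (image (image f) ` MM)"
    unfolding disjoint_induced_matching_cover_def
  proof (intro conjI ballI)
    show "finite (image (image f) ` MM)" "\<Union>(image (image f) ` MM) = image f ` E"
      using MM by (auto simp: disjoint_induced_matching_cover_def)
    show "induced_matching (image f ` E) M" if "M \<in> image (image f) ` MM" for M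
      using that MM induced_matching_image[OF f E]
      by (auto simp: disjoint_induced_matching_cover_def)
    have "disjnt (image f ` A) (image f ` B)" if "A \<in> MM" "B \<in> MM" "A \<noteq> B" for A B
    proof -
      have "A \<inter> B = {}"
        using MM that by (auto simp: disjoint_induced_matching_cover_def pairwise_def disjnt_def)
      then show ?thesis
        using inj_on_image_Int[OF fP sub[OF that(1)] sub[OF that(2)]] by (simp add: disjnt_def)
    qed
    then show "pairwise disjnt (image (image f) ` MM)"
      by (auto simp: pairwise_def)
  qed
  moreover have "card (image (image f) ` MM) \<le> card MM"
    using MM by (intro card_image_le) (simp add: disjoint_induced_matching_cover_def)
  ultimately show ?thesis
    using card_image[OF f] card_image[OF fP] by blast
qed

section \<open>Parameters of the code graph\<close>

text \<open>Collects both bounds in multiplicative form, before they are rewritten as powers of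
  \<open>C ^ n\<close>.\<close>

lemma code_graph_parameters:
  fixes n d C :: nat
  assumes d: "0 < d" "2 * d \<le> n" and C: "2 \<le> C" and nd: "real n \<le> real d * real C"
  defines "h \<equiv> binary_entropy (real d / real n)"
  shows "\<exists>(V :: nat set) E MM. simple_graph V E \<and> card V = C ^ n \<and>
      disjoint_induced_matching_cover E MM \<and>
      real ((C ^ n) choose 2) - real (card E)
        \<le> real C ^ n * (2 powr (real n * h) * (real C - 1) ^ (n - d)) \<and>
      real (card MM) * 2 ^ n \<le> real C ^ (2 * n) * 2 powr (real n * h)"
proof -
  define I Q where "I = {..<n}" and "Q = {..<C}"
  have IQ: "finite I" "card I = n" "finite Q" "card Q = C" by (auto simp: I_def Q_def)
  define D where "D = card {S \<in> Pow I. card S < d}"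
  obtain L where L: "linear_code I d L" "2 ^ n \<le> card L * D"
    using gilbert_varshamov[OF IQ(1) d(1)] IQ d by (auto simp: D_def)
  interpret code_graph I Q d L
    using IQ L d by unfold_locales auto
  have cw: "card words = C ^ n" using IQ by (simp add: card_PiE)
  define b where "b = 2 powr (real n * h) * (real C - 1) ^ (n - d)"
  \<comment> \<open>\<open>card_missing\<close> takes a natural number as bound, hence the floor of
    the real \<open>b\<close>.\<close>
  have ball: "card {y \<in> words. d \<le> card (agreement I (x, y))} \<le> nat \<lfloor>b\<rfloor>" if "x \<in> words" for x
    using card_large_agreement_entropy[OF IQ(1,2,3) d(1) _ _ _ that] d C nd IQ
    by (simp add: le_nat_floor b_def h_def)
  have "C ^ n choose 2 \<le> card edges + C ^ n * nat \<lfloor>b\<rfloor>"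
    using card_missing[OF ball] cw by simp
  then have "real (C ^ n choose 2) \<le> real (card edges + C ^ n * nat \<lfloor>b\<rfloor>)"
    by (simp only: of_nat_le_iff)
  also have "\<dots> \<le> real (card edges) + real C ^ n * b"
    using C by (auto simp: b_def intro!: mult_left_mono)
  finally have missing: "real (C ^ n choose 2) - real (card edges) \<le> real C ^ n * b" by simp
  \<comment> \<open>Replacing \<open>2 ^ n\<close> by the Gilbert-Varshamov product brings in
    \<open>card L\<close>, which \<open>card_matchings\<close> then absorbs.\<close>
  have "card matchings * 2 ^ n \<le> card matchings * (card L * D)"
    using L by (intro mult_left_mono) auto
  also have "\<dots> = (card matchings * card L) * D" by (simp add: mult.assoc)
  also have "\<dots> \<le> (C ^ n) ^ 2 * D"
    using card_matchings cw by (intro mult_right_mono) auto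
  finally have "card matchings * 2 ^ n \<le> C ^ (2 * n) * D"
    by (simp add: mult.commute flip: power_mult)
  then have "real (card matchings * 2 ^ n) \<le> real (C ^ (2 * n) * D)"
    by (simp only: of_nat_le_iff)
  also have "\<dots> \<le> real C ^ (2 * n) * 2 powr (real n * h)"
    using card_small_subsets_entropy[OF IQ(1,2) d] by (auto simp: D_def h_def intro!: mult_left_mono)
  finally have count: "real (card matchings) * 2 ^ n \<le> real C ^ (2 * n) * 2 powr (real n * h)"
    by simp
  obtain V :: "nat set" and E MM where *: "simple_graph V E" "card V = card words"
     "card E = card edges" "disjoint_induced_matching_cover E MM" "card MM \<le> card matchings"
    using relabel_to_nat[OF simple_graph_edges matchings_cover] by blast
  have "real (card MM) * 2 ^ n \<le> real (card matchings) * 2 ^ n"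
    using * by (intro mult_right_mono) auto
  from order_trans[OF this count] show ?thesis
    using * missing cw by (intro exI[of _ V] exI[of _ E] exI[of _ MM]) (auto simp: b_def)
qed

text \<open>As \<open>C ^ n\<close> is 2 to the power \<open>n * log 2 C\<close>, dividing an
  exponent by \<open>log 2 C\<close> changes the base to 2.\<close>

lemma power_powr_div_log:
  fixes C :: nat
  assumes "2 \<le> C"
  shows "real (C ^ n) powr (a + z / log 2 (real C)) = real (C ^ n) powr a * 2 powr (real n * z)"
proof -
  have "real (C ^ n) powr (z / log 2 (real C)) = (2 powr (real n * log 2 (real C))) powr (z / log 2 (real C))"
    using assms by (simp add: powr_realpow[symmetric] powr_powr[symmetric] powr_mult mult.commute[of "real n"])
  also have "\<dots> = 2 powr (real n * z)"
    using assms by (simp add: powr_powr less_imp_neq[THEN not_sym, of 0 "log 2 (real C)"])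
  finally show ?thesis by (simp add: powr_add)
qed

theorem theorem2p21:
  "\<exists>\<epsilon> \<delta> :: nat \<Rightarrow> nat \<Rightarrow> real.
     (\<forall>C. (\<lambda>n. \<epsilon> C n) \<longlonglongrightarrow> 0 \<and> (\<lambda>n. \<delta> C n) \<longlonglongrightarrow> 0) \<and>
     (\<forall>n d C :: nat.
        0 < n \<longrightarrow> 0 < d \<longrightarrow> 2 * d \<le> n \<longrightarrow> 2 \<le> C \<longrightarrow>
        real d / real n \<ge> 2 / (real C - 1) \<longrightarrow>
        (\<exists>(V :: nat set) E MM.
           simple_graph V E \<and> card V = C ^ n \<and>
           real ((C ^ n) choose 2) - real (card E)
             \<le> real (C ^ n) powr
                 (1 + (binary_entropy (real d / real n)
                        + (1 - real d / real n) * log 2 (real C - 1)) / log 2 (real C)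
                    + \<epsilon> C n) \<and>
           disjoint_induced_matching_cover E MM \<and>
           real (card MM)
             \<le> real (C ^ n) powr
                 (2 - (1 - binary_entropy (real d / real n)) / log 2 (real C) + \<delta> C n)))"
proof (intro exI[of _ "\<lambda>_ _. 0"] conjI allI impI)
  fix n d C :: nat
  assume n: "0 < n" and d: "0 < d" "2 * d \<le> n" and C: "2 \<le> C"
    and dn: "real d / real n \<ge> 2 / (real C - 1)"
  define h where "h = binary_entropy (real d / real n)"
  \<comment> \<open>The density assumption enters through its consequence \<open>nd\<close>, the
    mean condition of \<open>card_large_agreement_entropy\<close>.\<close>
  have "2 * real n \<le> real d * (real C - 1)"
    using dn n C by (simp add: field_simps)
  then have nd: "real n \<le> real d * real C"
    using d by (simp add: algebra_simps)
  obtain V :: "nat set" and E MM where G: "simple_graph V E" "card V = C ^ n"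
      "disjoint_induced_matching_cover E MM"
    and missing: "real ((C ^ n) choose 2) - real (card E)
        \<le> real C ^ n * (2 powr (real n * h) * (real C - 1) ^ (n - d))"
    and count: "real (card MM) * 2 ^ n \<le> real C ^ (2 * n) * 2 powr (real n * h)"
    using code_graph_parameters[OF d C nd] unfolding h_def by blast
  have "real n * (1 - real d / real n) = real (n - d)"
    using n d by (simp add: field_simps of_nat_diff)
  then have "real n * ((1 - real d / real n) * log 2 (real C - 1)) = real (n - d) * log 2 (real C - 1)"
    by (simp only: mult.assoc[symmetric])
  then have "2 powr (real n * (h + (1 - real d / real n) * log 2 (real C - 1)))
      = 2 powr (real n * h) * 2 powr (real (n - d) * log 2 (real C - 1))"
    by (simp only: distrib_left powr_add)
  also have "2 powr (real (n - d) * log 2 (real C - 1)) = (real C - 1) ^ (n - d)"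
    using C by (simp add: powr_powr[symmetric] powr_realpow mult.commute[of "real (n - d)"])
  finally have e: "real (C ^ n) powr (1 + (h + (1 - real d / real n) * log 2 (real C - 1)) / log 2 (real C))
      = real C ^ n * (2 powr (real n * h) * (real C - 1) ^ (n - d))"
    using power_powr_div_log[OF C, of n 1] C by simp
  have "real (card MM) \<le> real C ^ (2 * n) * 2 powr (real n * h) / 2 ^ n"
    using count by (simp add: field_simps)
  also have "\<dots> = real (C ^ n) powr 2 * 2 powr (real n * (h - 1))"
    using C by (simp add: right_diff_distrib powr_diff powr_realpow power_mult[symmetric] mult.commute)
  also have "\<dots> = real (C ^ n) powr (2 + (h - 1) / log 2 (real C))"
    by (rule power_powr_div_log[OF C, symmetric])
  also have "2 + (h - 1) / log 2 (real C) = 2 - (1 - h) / log 2 (real C)"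
    by (simp add: diff_divide_distrib)
  finally have f: "real (card MM) \<le> real (C ^ n) powr (2 - (1 - h) / log 2 (real C))" .
  show "\<exists>(V :: nat set) E MM.
           simple_graph V E \<and> card V = C ^ n \<and>
           real ((C ^ n) choose 2) - real (card E)
             \<le> real (C ^ n) powr
                 (1 + (binary_entropy (real d / real n)
                        + (1 - real d / real n) * log 2 (real C - 1)) / log 2 (real C) + 0) \<and>
           disjoint_induced_matching_cover E MM \<and>
           real (card MM)
             \<le> real (C ^ n) powr
                 (2 - (1 - binary_entropy (real d / real n)) / log 2 (real C) + 0)"
    using G missing e f unfolding h_def by (intro exI[of _ V] exI[of _ E] exI[of _ MM]) simp
qed simp_all

end
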